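(* Let $(b,c)\in\{(1,4),(4,1)\}$. (1) Let $x,y$ be non-commuting indeterminates and $C=xyx^{-1}y^{-1}$. Let $(R_n)_{n\in\mathbb Z}$ be the solution of the $(b,c)$-system with $C$ as the coefficient and initial data $R_0=yxy^{-1}$, $R_1=y$ (so that $CR_0=x$). Then for every $n\in\mathbb Z$, $R_n$ is a Laurent polynomial in $x,y$ with non-negative integer coefficients. (2) Let $X,Y$ be non-commuting indeterminates and $C=XYX^{-1}Y^{-1}$. Let $(R_n)_{n\in\mathbb Z}$ be the solution of the $(b,c)$-system with $C$ as the coefficient and initial data $R_1=YXY^{-1}$, $R_2=Y$ (so that $CR_1=X$). Then for every $n\in\mathbb Z$, $R_n$ is a Laurent polynomial in $X,Y$ with non-negative integer coefficients.
   Context: For two non-commuting indeterminates $u,v$ (here $u,v$ stands for $x,y$ or $X,Y$), work in the free skew field over $\mathbb C$ generated by $u,v$, i.e. the skew field of non-commutative rational functions in $u,v$. A (non-commutative) Laurent polynomial in $u,v$ is a $\mathbb Z$-linear combination of words (Laurent monomials) in $u^{\pm1},v^{\pm1}$. It has non-negative integer coefficients if all coefficients of its expansion in reduced words are in $\mathbb Z_{\ge 0}$. For non-negative integers $b,c$ and a given element $C$, the $(b,c)$-system is the recursion $$R_{n+1}\,C\,R_{n-1}=\begin{cases}1+R_n^{b}, & n\text{ odd},\\ 1+R_n^{c}, & n \text{ even},\end{cases}\qquad n\in\mathbb Z.$$ Given two consecutive values, this recursion determines $R_n$ uniquely for all $n\in\mathbb Z$. *)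

theory Defs
  imports Main
begin

text \<open>The free group on two generators, realised by freely reduced words, and its
  integral group ring (non-commutative Laurent polynomials in two variables).\<close>

datatype gen = Gx | Gy

text \<open>A letter is a generator together with a sign: True = the generator, False = its inverse.\<close>
type_synonym letter = "gen \<times> bool"

definition cancels :: "letter \<Rightarrow> letter \<Rightarrow> bool" where
  "cancels l m \<longleftrightarrow> fst l = fst m \<and> snd l \<noteq> snd m"

fun push :: "letter \<Rightarrow> letter list \<Rightarrow> letter list" where
  "push l [] = [l]"
| "push l (m # ms) = (if cancels l m then ms else l # m # ms)"

definition reduce :: "letter list \<Rightarrow> letter list" where
  "reduce w = foldr push w []"

text \<open>A Laurent polynomial: finitely supported integer-valued function on reduced words
  (the coefficient of each reduced word, i.e. each Laurent monomial).\<close>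
type_synonym lpoly = "letter list \<Rightarrow> int"

definition is_lpoly :: "lpoly \<Rightarrow> bool" where
  "is_lpoly p \<longleftrightarrow> finite {w. p w \<noteq> 0} \<and> (\<forall>w. p w \<noteq> 0 \<longrightarrow> reduce w = w)"

definition lp_nonneg :: "lpoly \<Rightarrow> bool" where
  "lp_nonneg p \<longleftrightarrow> (\<forall>w. p w \<ge> 0)"

definition lp_one :: lpoly where
  "lp_one = (\<lambda>w. if w = [] then 1 else 0)"

definition lp_mono :: "letter list \<Rightarrow> lpoly" where
  "lp_mono u = (\<lambda>w. if w = reduce u then 1 else 0)"

definition lp_add :: "lpoly \<Rightarrow> lpoly \<Rightarrow> lpoly" where
  "lp_add p q = (\<lambda>w. p w + q w)"

definition lp_mult :: "lpoly \<Rightarrow> lpoly \<Rightarrow> lpoly" where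
  "lp_mult p q = (\<lambda>w. \<Sum>(u, v) \<in> {(u, v). p u \<noteq> 0 \<and> q v \<noteq> 0 \<and> reduce (u @ v) = w}.
                        p u * q v)"

fun lp_pow :: "lpoly \<Rightarrow> nat \<Rightarrow> lpoly" where
  "lp_pow p 0 = lp_one"
| "lp_pow p (Suc k) = lp_mult p (lp_pow p k)"

abbreviation (input) "gx \<equiv> (Gx, True)"
abbreviation (input) "gx' \<equiv> (Gx, False)"
abbreviation (input) "gy \<equiv> (Gy, True)"
abbreviation (input) "gy' \<equiv> (Gy, False)"

definition lp_C :: lpoly where
  "lp_C = lp_mono [gx, gy, gx', gy']"

definition bc_system :: "nat \<Rightarrow> nat \<Rightarrow> lpoly \<Rightarrow> (int \<Rightarrow> lpoly) \<Rightarrow> bool" where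
  "bc_system b c C R \<longleftrightarrow>
     (\<forall>n::int. lp_mult (lp_mult (R (n + 1)) C) (R (n - 1))
                = lp_add lp_one (lp_pow (R n) (if odd n then b else c)))"

end

theory Submission
  imports Defs "HOL-Library.Poly_Mapping"
begin

text \<open>
  The members of the solution that enter with exponent \<open>4\<close> form a sequence \<open>w k\<close>, between
  which the other members are \<open>w (k + 1) * C * w k - 1\<close>. This sequence has a conserved quantity
  \<open>K = (w 1 + C * w (-1)) * (w 0)\<^sup>-\<^sup>1\<close>, a Laurent polynomial with non-negative coefficients,
  so \<open>w\<close> satisfies \<open>K * w k = w (k + 1) + C * w (k - 1)\<close>, and also the mirrored
  \<open>w k * K = w (k + 1) * C + w (k - 1)\<close>. Conversely, if \<open>w\<close> is defined by the linear
  recursion, then the mirrored recursion, the quasi-commutation of neighbours and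
  \<open>w (k + 1) * C * w (k - 1) = w k * w k + K\<close> propagate from the initial data, and together
  they give the exchange relation.

  For positivity, \<open>K = m + n + h\<close> with monomials \<open>m\<close>, \<open>n\<close> such that \<open>m * n = C\<close>.
  This factors the recursion, which then runs without subtraction, and exhibits in \<open>w (k + 1)\<close>
  and \<open>w k\<close> extreme monomials coming from the powers of \<open>m\<close> and \<open>n\<close>. They account for a
  constant term \<open>1\<close> in \<open>w (k + 1) * C * w k\<close>, so subtracting \<open>1\<close> preserves positivity.
\<close>

section \<open>Two-sided linear recursions and their invariants\<close>

lemma int_sequence_constant:
  fixes d :: "int \<Rightarrow> 'a"
  assumes "\<And>k. d (k + 1) = d k"
  shows "d k = d 0"
proof (induction k rule: int_induct [where k = 0])
  case (step2 i)
  then show ?case using assms [of "i - 1"] by simp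
qed (use assms in auto)

text \<open>Since \<open>C\<close> is a unit, the step \<open>f\<close> on pairs of neighbours is
  undone by \<open>g\<close>; iterating \<open>f\<close> forwards and \<open>g\<close> backwards
  gives the whole sequence.\<close>

lemma ex_two_sided_recurrence:
  fixes K C C' w0 w1 :: "'a::ring_1"
  assumes "C * C' = 1" and "C' * C = 1"
  shows "\<exists>w :: int \<Rightarrow> 'a. w 0 = w0 \<and> w 1 = w1 \<and> (\<forall>k. w (k + 1) = K * w k - C * w (k - 1))"
proof -
  define f where "f = (\<lambda>(x, y). (y, K * y - C * x))"
  define g where "g = (\<lambda>(x, y). (C' * (K * x - y), x))"
  have fg: "f (g z) = z" for z
    by (cases z) (simp add: f_def g_def mult.assoc [symmetric] assms)
  define F where "F = (\<lambda>k. if k \<ge> 0 then (f ^^ nat k) (w0, w1) else (g ^^ nat (- k)) (w0, w1))"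
  have step: "F (k + 1) = f (F k)" for k
  proof (cases "k \<ge> 0")
    case True
    then show ?thesis by (simp add: F_def nat_add_distrib)
  next
    case False
    then have "nat (- k) = Suc (nat (- (k + 1)))" by simp
    with False show ?thesis
      by (cases "k = -1") (simp_all add: F_def fg)
  qed
  have fst_f: "fst (f z) = snd z" "snd (f z) = K * snd z - C * fst z" for z
    by (simp_all add: f_def split: prod.split)
  have snd_F: "snd (F k) = fst (F (k + 1))" for k
    by (simp add: step fst_f)
  have "fst (F (k + 1)) = K * fst (F k) - C * fst (F (k - 1))" for k
    using snd_F [of k] snd_F [of "k - 1"] step [of "k - 1"] fst_f(2) [of "F (k - 1)"] by simp
  moreover have "fst (F 0) = w0" "fst (F 1) = w1"
    using snd_F [of 0] by (simp_all add: F_def)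
  ultimately show ?thesis
    by (intro exI [of _ "\<lambda>k. fst (F k)"]) simp
qed

locale conserved_recurrence =
  fixes C C' K :: "'a::ring_1" and w :: "int \<Rightarrow> 'a"
  assumes inverse_C: "C * C' = 1" "C' * C = 1"
    and left_rec: "\<And>k. w (k + 1) = K * w k - C * w (k - 1)"
    and right_rec_0: "w 0 * K = w 1 * C + w (- 1)"
    and right_rec_1: "w 1 * K = w 2 * C + w 0"
    and commutation_0: "w 0 * w 1 = w 1 * C * w 0 + C' - 1"
    and determinant_0: "w 1 * C * w (- 1) = w 0 * w 0 + K"
begin

lemma left_rec2: "w (k + 2) = K * w (k + 1) - C * w k"
  using left_rec [of "k + 1"] by (simp add: add.assoc)

lemma left_rec': "w (k - 1) = C' * (K * w k - w (k + 1))"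
  by (simp add: left_rec [of k] mult.assoc [symmetric] inverse_C)

text \<open>Left and right multiplications commute, so the defect
  \<open>w k * K - w (k + 1) * C - w (k - 1)\<close> again satisfies the left recursion. This has
  order two and runs both ways, so vanishing at 0 and 1 suffices; hence the induction over two
  neighbouring indices.\<close>

lemma right_rec: "w k * K = w (k + 1) * C + w (k - 1)"
proof -
  let ?P = "\<lambda>k. w k * K = w (k + 1) * C + w (k - 1)"
  have "?P k \<and> ?P (k + 1)"
  proof (induction k rule: int_induct [where k = 0])
    case base
    show ?case using right_rec_0 right_rec_1 by simp
  next
    case (step1 i)
    have ih: "w i * K = w (i + 1) * C + w (i - 1)" "w (i + 1) * K = w (i + 2) * C + w i"
      using step1 by (simp_all only: add.assoc one_add_one add_diff_cancel_right')
    have "w (i + 2) * K = K * (w (i + 1) * K) - C * (w i * K)"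
      by (simp add: left_rec2 left_diff_distrib mult.assoc)
    also have "\<dots> = K * (w (i + 2) * C + w i) - C * (w (i + 1) * C + w (i - 1))"
      unfolding ih ..
    also have "\<dots> = (K * w (i + 2) - C * w (i + 1)) * C + (K * w i - C * w (i - 1))"
      by (simp add: algebra_simps)
    finally have "w (i + 2) * K = w (i + 3) * C + w (i + 1)"
      using left_rec2 [of "i + 1"] left_rec [of i] by (simp add: add.assoc)
    moreover have "i + 1 + 1 = i + 2" "i + 2 + 1 = i + 3" "i + 2 - 1 = i + 1" "i + 1 - 1 = i"
      by simp_all
    ultimately show ?case using ih by (simp only: conj_absorb simp_thms)
  next
    case (step2 i)
    have ih: "w i * K = w (i + 1) * C + w (i - 1)" "w (i + 1) * K = w (i + 2) * C + w i"
      using step2 by (simp_all only: add.assoc one_add_one add_diff_cancel_right')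
    have "w (i - 1) * K = C' * (K * (w i * K) - w (i + 1) * K)"
      by (simp add: left_rec' [of i] algebra_simps)
    also have "\<dots> = C' * (K * (w (i + 1) * C + w (i - 1)) - (w (i + 2) * C + w i))"
      unfolding ih ..
    also have "\<dots> = C' * (K * w (i + 1) - w (i + 2)) * C + C' * (K * w (i - 1) - w i)"
      by (simp add: algebra_simps)
    also have "C' * (K * w (i + 1) - w (i + 2)) = w i"
      by (simp add: left_rec2 mult.assoc [symmetric] inverse_C)
    also have "C' * (K * w (i - 1) - w i) = w (i - 1 - 1)"
      using left_rec' [of "i - 1"] by simp
    finally have "w (i - 1) * K = w i * C + w (i - 1 - 1)" .
    with step2 show ?case by simp
  qed
  then show ?thesis by simp
qed

text \<open>Evaluating \<open>w (k + 1) * K * w (k + 1)\<close> by the left and by the right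
  recursion shows that \<open>d\<close> is constant.\<close>

lemma commutation: "w k * w (k + 1) = w (k + 1) * C * w k + C' - 1"
proof -
  define d where "d k = w k * w (k + 1) - w (k + 1) * C * w k" for k
  have "d (k + 1) = d k" for k
  proof -
    have "w (k + 1) * (w (k + 2) + C * w k) = w (k + 1) * K * w (k + 1)"
      using left_rec [of "k + 1"] by (simp add: algebra_simps)
    also have "\<dots> = (w (k + 2) * C + w k) * w (k + 1)"
      using right_rec [of "k + 1"] by (simp add: algebra_simps)
    finally show ?thesis
      by (simp add: d_def algebra_simps)
  qed
  then have "d k = d 0" by (rule int_sequence_constant)
  also have "\<dots> = C' - 1" using commutation_0 by (simp add: d_def)
  finally show ?thesis by (simp add: d_def algebra_simps)
qed

text \<open>A non-commutative Casoratian: here \<open>w (k + 1) * K * w k\<close> is evaluated in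
  both ways.\<close>

lemma determinant: "w (k + 1) * C * w (k - 1) = w k * w k + K"
proof -
  define d where "d k = w (k + 1) * C * w (k - 1) - w k * w k" for k
  have "d (k + 1) = d k" for k
  proof -
    have "w (k + 2) * C * w k = (w (k + 1) * K - w k) * w k"
      using right_rec [of "k + 1"] by (simp add: algebra_simps)
    also have "\<dots> = w (k + 1) * (w (k + 1) + C * w (k - 1)) - w k * w k"
      using left_rec [of k] by (simp add: algebra_simps)
    finally show ?thesis
      by (simp add: d_def algebra_simps)
  qed
  then have "d k = d 0" by (rule int_sequence_constant)
  also have "\<dots> = K" using determinant_0 by (simp add: d_def)
  finally show ?thesis by (simp add: d_def algebra_simps)
qed

lemma exchange:
  "(w (k + 1) * C * w k - 1) * C * (w k * C * w (k - 1) - 1) = 1 + w k ^ 4"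
proof -
  \<comment> \<open>Commutation moves \<open>w k\<close> to the outer end of each factor. This
    brings \<open>w (k + 1) * C * w (k - 1)\<close> together in the middle, where
    \<open>determinant\<close> applies.\<close>
  have com: "w k * C * w (k - 1) - 1 = w (k - 1) * w k - C'"
    using commutation [of "k - 1"] by simp
  have "w (k + 1) * C * w k - 1 = w k * w (k + 1) - C'"
    using commutation [of k] by simp
  then have "(w (k + 1) * C * w k - 1) * C * (w k * C * w (k - 1) - 1)
      = (w k * w (k + 1) * C - 1) * (w k * C * w (k - 1) - 1)"
    by (simp add: left_diff_distrib inverse_C)
  also have "\<dots> = w k * (w (k + 1) * C * (w k * C * w (k - 1) - 1)) - (w k * C * w (k - 1) - 1)"
    by (simp add: algebra_simps)
  also have "w (k + 1) * C * (w k * C * w (k - 1) - 1)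
      = (w (k + 1) * C * w (k - 1)) * w k - w (k + 1) * (C * C')"
    unfolding com by (simp add: algebra_simps)
  also have "\<dots> = w k ^ 3 + C * w (k - 1)"
    unfolding determinant inverse_C using left_rec [of k]
    by (simp add: algebra_simps power3_eq_cube)
  finally show ?thesis
    by (simp add: algebra_simps eval_nat_numeral)
qed

end

subsection \<open>Positivity\<close>

locale positive_cone =
  fixes P :: "'a::ring_1 set"
  assumes zero_mem: "0 \<in> P" and one_mem: "1 \<in> P"
    and add_mem: "\<And>x y. x \<in> P \<Longrightarrow> y \<in> P \<Longrightarrow> x + y \<in> P"
    and mult_mem: "\<And>x y. x \<in> P \<Longrightarrow> y \<in> P \<Longrightarrow> x * y \<in> P"
begin

lemma power_mem: "x \<in> P \<Longrightarrow> x ^ k \<in> P"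
  by (induction k) (auto intro: one_mem mult_mem)

lemma mem_of_diff: "x - y \<in> P \<Longrightarrow> y \<in> P \<Longrightarrow> x \<in> P"
  using add_mem [of "x - y" y] by simp

lemma mult_diff_mem:
  assumes "x - x0 \<in> P" "y - y0 \<in> P" "x0 \<in> P" "y0 \<in> P"
  shows "x * y - x0 * y0 \<in> P"
proof -
  have "x * y - x0 * y0 = (x - x0) * y + x0 * (y - y0)"
    by (simp add: algebra_simps)
  also have "\<dots> \<in> P"
    using assms mem_of_diff by (intro add_mem mult_mem) auto
  finally show ?thesis .
qed

text \<open>The recursion operator \<open>S\<^sup>2 - (m + n + h) S + m n\<close>, with \<open>S\<close> the shift, factors as
  \<open>(S - m) (S - n) - h S\<close>; so \<open>v k = u (k + 1) - n * u k\<close> evolves without subtraction.\<close>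

lemma factored_recurrence:
  fixes u :: "nat \<Rightarrow> 'a"
  assumes mem: "m \<in> P" "n \<in> P" "h \<in> P" "u 0 \<in> P" "p \<in> P" "u 1 - n * u 0 - p \<in> P"
    and rec: "\<And>k. u (k + 2) = (m + n + h) * u (k + 1) - m * n * u k"
  shows "u k \<in> P" and "u k - n ^ k * u 0 \<in> P" and "u (k + 1) - m ^ k * p \<in> P"
proof -
  have v_rec: "u (k + 2) - n * u (k + 1) = m * (u (k + 1) - n * u k) + h * u (k + 1)" for k
    unfolding rec by (simp add: algebra_simps)
  \<comment> \<open>A difference in \<open>P\<close> acts as a lower bound: \<open>v (k + 1)\<close>
    dominates \<open>m * v k\<close>, which carries \<open>m ^ k * p\<close> along, and
    \<open>u (k + 1)\<close> dominates \<open>n * u k\<close>, which carries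
    \<open>n ^ k * u 0\<close> along.\<close>
  have u_mem: "u k \<in> P \<and> u (k + 1) - n * u k - m ^ k * p \<in> P
      \<and> u k - n ^ k * u 0 \<in> P" for k
  proof (induction k)
    case 0
    then show ?case using mem zero_mem by simp
  next
    case (Suc k)
    let ?v = "u (k + 1) - n * u k"
    have mp: "m ^ k * p \<in> P" using mem by (intro mult_mem power_mem)
    then have v: "?v \<in> P" using Suc mem_of_diff [of ?v "m ^ k * p"] by auto
    have u: "u (k + 1) \<in> P"
      using add_mem [OF mult_mem [OF \<open>n \<in> P\<close>] v, of "u k"] Suc by simp
    have "m * (?v - m ^ k * p) + h * u (k + 1) \<in> P"
      using Suc mem u by (auto intro: add_mem mult_mem)
    also have "m * (?v - m ^ k * p) + h * u (k + 1) = u (k + 2) - n * u (k + 1) - m ^ (k + 1) * p"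
      unfolding v_rec by (simp add: algebra_simps)
    finally have "u (k + 2) - n * u (k + 1) - m ^ (k + 1) * p \<in> P" .
    moreover have "n * (u k - n ^ k * u 0) + ?v \<in> P"
      using Suc mem v by (auto intro: add_mem mult_mem)
    then have "u (k + 1) - n ^ (k + 1) * u 0 \<in> P"
      by (simp add: algebra_simps)
    ultimately show ?case using u by simp
  qed
  then show "u k \<in> P" "u k - n ^ k * u 0 \<in> P" by blast+
  have "u (k + 1) - m ^ k * p = n * u k + (u (k + 1) - n * u k - m ^ k * p)"
    by (simp add: algebra_simps)
  also have "\<dots> \<in> P"
    using u_mem [of k] mem(2) by (intro add_mem mult_mem) blast+
  finally show "u (k + 1) - m ^ k * p \<in> P" .
qed

end

lemma power_sandwich:
  fixes x y z :: "'a::monoid_mult"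
  assumes "x * z * y = z"
  shows "x ^ k * z * y ^ k = z"
proof (induction k)
  case (Suc k)
  have "x ^ Suc k * z * y ^ Suc k = x ^ k * (x * z * y) * y ^ k"
    by (simp only: power_Suc2 [of x] power_Suc [of y] mult.assoc)
  with Suc show ?case by (simp add: assms)
qed simp

text \<open>The forms of \<open>w 1\<close> and \<open>w (- 1)\<close> display the seeds of the
  extreme monomials. Forwards, \<open>q\<close> is propagated by \<open>n\<close> and
  \<open>q' * C'\<close> by \<open>m\<close>; backwards, \<open>q\<close> is propagated by
  \<open>C' * m\<close> and \<open>C' * q'\<close> by \<open>C' * n\<close>. The remainders are
  \<open>z\<close> and \<open>z'\<close>.\<close>

locale positive_recurrence = positive_cone P + conserved_recurrence C C' K w
  for P :: "'a::ring_1 set" and C C' K w +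
  fixes q q' m n h z z' :: 'a
  assumes inverse_q: "q * q' = 1" "q' * q = 1"
    and C_eq: "C = m * n" and sandwich: "n * q * m = q"
    and K_eq: "K = m + n + h"
    and w_0: "w 0 = q"
    and w_1: "w 1 = n * q + q' * C' + z"
    and w_minus_1: "w (- 1) = C' * m * q + C' * q' + z'"
    and mem: "m \<in> P" "n \<in> P" "h \<in> P" "q \<in> P" "q' \<in> P" "C' \<in> P" "z \<in> P" "z' \<in> P"
begin

lemma C_mem: "C \<in> P"
  unfolding C_eq using mem by (intro mult_mem)

text \<open>The term \<open>m ^ k * q' * C'\<close> of \<open>w (k + 1)\<close> and the term
  \<open>n ^ k * q\<close> of \<open>w k\<close> give \<open>m ^ k * q' * n ^ k * q = 1\<close> in
  the product with \<open>C\<close>.\<close>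

lemma forward_mem: "w (int k) \<in> P" "w (int k + 1) * C * w (int k) - 1 \<in> P"
proof -
  have "w (int k + 2) = (m + n + h) * w (int k + 1) - m * n * w (int k)" for k
    using left_rec2 [of "int k"] by (simp add: K_eq C_eq)
  then have rec: "w (int (k + 2)) = (m + n + h) * w (int (k + 1)) - m * n * w (int k)" for k
    by (simp add: add.commute)
  have p_mem: "q' * C' \<in> P" "n ^ k * q \<in> P" "m ^ k * (q' * C') * C \<in> P"
    using mem C_mem by (auto intro!: mult_mem power_mem)
  have init: "w (int 1) - n * w (int 0) - q' * C' \<in> P" "w (int 0) \<in> P"
    using mem by (simp_all add: w_0 w_1)
  note pos = factored_recurrence [of m n h "\<lambda>k. w (int k)" "q' * C'",
      OF mem(1-3) init(2) p_mem(1) init(1) rec]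
  show "w (int k) \<in> P" by (rule pos(1))
  \<comment> \<open>Goal: \<open>m * q' * n = q'\<close>, the counterpart of \<open>sandwich\<close>
    for \<open>q'\<close>. Inserting \<open>m * n * C' = 1\<close> makes \<open>n * q * m\<close>
    appear.\<close>
  have "m * q' * n * q = m * q' * n * q * (m * n * C')"
    using inverse_C by (simp add: C_eq)
  also have "\<dots> = m * q' * (n * q * m) * n * C'"
    by (simp only: mult.assoc)
  also have "\<dots> = m * (q' * q) * n * C'"
    unfolding sandwich by (simp only: mult.assoc)
  also have "\<dots> = 1"
    using inverse_C by (simp add: inverse_q C_eq)
  finally have "m * q' * n * (q * q') = q'"
    by (simp add: mult.assoc [symmetric])
  then have "m ^ k * q' * n ^ k = q'"
    by (intro power_sandwich) (simp add: inverse_q)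
  then have "m ^ k * (q' * (C' * C)) * (n ^ k * q) = 1"
    by (simp add: inverse_C inverse_q mult.assoc [symmetric])
  then have one: "m ^ k * (q' * C') * C * (n ^ k * q) = 1"
    by (simp add: mult.assoc)
  have "w (int k + 1) * C - m ^ k * (q' * C') * C \<in> P"
    using mult_mem [OF pos(3) [of k] C_mem] by (simp add: left_diff_distrib add.commute)
  moreover have "w (int k) - n ^ k * q \<in> P"
    using pos(2) [of k] by (simp add: w_0)
  ultimately show "w (int k + 1) * C * w (int k) - 1 \<in> P"
    using mult_diff_mem p_mem one by metis
qed

text \<open>Solved for the lower index, the recursion has the same shape with \<open>C' * n\<close>,
  \<open>C' * m\<close>, \<open>C' * h\<close> in place of \<open>m\<close>, \<open>n\<close>,
  \<open>h\<close>, because \<open>n * C' * m = 1\<close> factors \<open>C'\<close> accordingly. The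
  sandwiched element is now \<open>q * C\<close>.\<close>

lemma backward_mem: "w (- int k) \<in> P" "w (- int k) * C * w (- int k - 1) - 1 \<in> P"
proof -
  have "n * C' = (q' * (n * q * m)) * n * C'"
    unfolding sandwich by (simp add: inverse_q)
  also have "\<dots> = q' * n * q * (m * n * C')"
    by (simp only: mult.assoc)
  finally have "n * C' * m = q' * (n * q * m)"
    using inverse_C by (simp add: C_eq mult.assoc)
  then have nCm: "n * C' * m = 1"
    by (simp add: sandwich inverse_q)
  have C'_eq: "C' = (C' * n) * (C' * m)"
    using nCm by (simp add: mult.assoc)
  have rec0: "w (- int k - 2) = C' * (n + m + h) * w (- int k - 1) - C' * w (- int k)" for k
    using left_rec' [of "- int k - 1"] by (simp add: K_eq algebra_simps)
  then have rec: "w (- int (k + 2)) = (C' * n + C' * m + C' * h) * w (- int (k + 1))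
      - (C' * n) * (C' * m) * w (- int k)" for k
  proof -
    have "- int (k + 2) = - int k - 2" "- int (k + 1) = - int k - 1" by simp_all
    then show ?thesis
      unfolding C'_eq [symmetric] using rec0 [of k] by (simp only: distrib_left)
  qed
  have mem': "C' * n \<in> P" "C' * m \<in> P" "C' * h \<in> P" "C' * q' \<in> P"
    using mem by (auto intro: mult_mem)
  have p_mem: "(C' * m) ^ k * q * C \<in> P" "(C' * n) ^ k * (C' * q') \<in> P"
    using mem mem' C_mem by (auto intro!: mult_mem power_mem)
  have init: "w (- int 1) - C' * m * w (- int 0) - C' * q' \<in> P" "w (- int 0) \<in> P"
    using mem by (simp_all add: w_0 w_minus_1)
  note pos = factored_recurrence [of "C' * n" "C' * m" "C' * h" "\<lambda>k. w (- int k)" "C' * q'",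
      OF mem'(1-3) init(2) mem'(4) init(1) rec]
  show "w (- int k) \<in> P" by (rule pos(1))
  have "C' * m * (q * C) * (C' * n) = C' * m * q * (C * C') * n"
    by (simp only: mult.assoc)
  also have "\<dots> = C' * m * (n * q * m) * n"
    by (simp add: inverse_C sandwich)
  also have "\<dots> = (C' * C) * q * C"
    by (simp only: C_eq mult.assoc)
  also have "\<dots> = q * C"
    by (simp add: inverse_C)
  finally have "(C' * m) ^ k * (q * C) * (C' * n) ^ k = q * C"
    by (rule power_sandwich)
  then have "(C' * m) ^ k * (q * C) * (C' * n) ^ k * (C' * q') = q * (C * C') * q'"
    by (simp add: mult.assoc)
  then have one: "(C' * m) ^ k * q * C * ((C' * n) ^ k * (C' * q')) = 1"
    by (simp add: mult.assoc inverse_C inverse_q)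
  have "w (- int k) * C - (C' * m) ^ k * q * C \<in> P"
    using mult_mem [OF pos(2) [of k] C_mem] by (simp add: left_diff_distrib w_0)
  moreover have "w (- int k - 1) - (C' * n) ^ k * (C' * q') \<in> P"
    using pos(3) [of k] by (simp add: minus_diff_commute [symmetric])
  ultimately show "w (- int k) * C * w (- int k - 1) - 1 \<in> P"
    using mult_diff_mem p_mem one by metis
qed

lemma w_mem: "w k \<in> P"
  using forward_mem(1) [of "nat k"] backward_mem(1) [of "nat (- k)"] by (cases "k \<ge> 0") auto

lemma product_mem: "w (k + 1) * C * w k - 1 \<in> P"
proof (cases "k \<ge> 0")
  case True
  then show ?thesis using forward_mem(2) [of "nat k"] by simp
next
  case False
  then have "- int (nat (- k - 1)) = k + 1" "- int (nat (- k - 1)) - 1 = k" by simp_all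
  then show ?thesis using backward_mem(2) [of "nat (- k - 1)"] by (simp only:)
qed

end

subsection \<open>The two systems over a ring\<close>

definition solves :: "nat \<Rightarrow> nat \<Rightarrow> 'a::ring_1 \<Rightarrow> (int \<Rightarrow> 'a) \<Rightarrow> bool" where
  "solves b c C R \<longleftrightarrow>
     (\<forall>n. R (n + 1) * C * R (n - 1) = 1 + R n ^ (if odd n then b else c))"

lemma solves_shift: "solves b c C R \<Longrightarrow> solves c b C (\<lambda>n. R (n - 1))"
  unfolding solves_def
proof
  fix n :: int
  assume "\<forall>n. R (n + 1) * C * R (n - 1) = 1 + R n ^ (if odd n then b else c)"
  from this [rule_format, of "n - 1"]
  show "R (n + 1 - 1) * C * R (n - 1 - 1) = 1 + R (n - 1) ^ (if odd n then c else b)"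
    by simp
qed

text \<open>At odd indices the relation merely restates how the intermediate members are defined; at
  even indices it is \<open>exchange\<close>.\<close>

lemma (in conserved_recurrence) solves_even:
  "solves 1 4 C (\<lambda>n. if even n then w (n div 2) else w (n div 2 + 1) * C * w (n div 2) - 1)"
  (is "solves 1 4 C ?R")
  unfolding solves_def
proof
  fix n :: int
  show "?R (n + 1) * C * ?R (n - 1) = 1 + ?R n ^ (if odd n then 1 else 4)"
  proof (cases "even n")
    case True
    then obtain k where k: "n = 2 * k" by (rule evenE)
    have "(2 * k + 1) div 2 = k" "(2 * k - 1) div 2 = k - 1" by simp_all
    then show ?thesis using exchange [of k] by (simp add: k)
  next
    case False
    then obtain k where "n = 2 * k + 1" by (rule oddE)
    then have "(n + 1) div 2 = k + 1" "(n - 1) div 2 = k" "n div 2 = k" by simp_all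
    with False show ?thesis by simp
  qed
qed

lemma (in conserved_recurrence) solves_odd:
  "solves 4 1 C (\<lambda>n. if odd n then w (n div 2) else w (n div 2) * C * w (n div 2 - 1) - 1)"
  (is "solves 4 1 C ?R")
proof -
  have "(\<lambda>n. if even (n - 1) then w ((n - 1) div 2)
      else w ((n - 1) div 2 + 1) * C * w ((n - 1) div 2) - 1) = ?R"
  proof
    fix n :: int
    show "(if even (n - 1) then w ((n - 1) div 2)
      else w ((n - 1) div 2 + 1) * C * w ((n - 1) div 2) - 1) = ?R n"
    proof (cases "even n")
      case True
      then obtain k where "n = 2 * k" by (rule evenE)
      moreover have "(2 * k - 1) div 2 = k - 1" by simp
      ultimately show ?thesis by simp
    next
      case False
      then obtain k where "n = 2 * k + 1" by (rule oddE)
      then show ?thesis by (simp add: add.commute)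
    qed
  qed
  with solves_shift [OF solves_even] show ?thesis by simp
qed

text \<open>Here \<open>a\<close> and \<open>r\<close> stand for the initial values \<open>y x y\<^sup>-\<^sup>1\<close> and \<open>y\<close>. As
  \<open>x = r\<^sup>-\<^sup>1 a r\<close>, the commutator of \<open>x\<close> and \<open>y\<close> is \<open>r\<^sup>-\<^sup>1 a r a\<^sup>-\<^sup>1\<close>.\<close>

locale positive_pair = positive_cone P for P :: "'a::ring_1 set" +
  fixes a a' r r' :: 'a
  assumes inv: "a * a' = 1" "a' * a = 1" "r * r' = 1" "r' * r = 1"
    and mem: "a \<in> P" "a' \<in> P" "r \<in> P" "r' \<in> P"
begin

lemma cancel: "a * (a' * x) = x" "a' * (a * x) = x" "r * (r' * x) = x" "r' * (r * x) = x"
  by (simp_all add: inv mult.assoc [symmetric])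

lemmas unit_simps = inv cancel algebra_simps

definition "C = r' * a * r * a'"
definition "C' = a * r' * a' * r"

lemma inverse_C: "C * C' = 1" "C' * C = 1"
  by (simp_all add: C_def C'_def unit_simps)

lemma positive_solution_1_4: "\<exists>R. (\<forall>n. R n \<in> P) \<and> R 0 = a \<and> R 1 = r \<and> solves 1 4 C R"
proof -
  \<comment> \<open>Solving \<open>r = w 1 * C * w 0 - 1\<close> with \<open>w 0 = a\<close> gives
    \<open>w 1 = (1 + r) * a' * C'\<close>. The exchange relation at index 0 then gives
    \<open>w (- 1)\<close>, and \<open>K\<close> is \<open>(w 1 + C * w (- 1)) * a'\<close>
    expanded.\<close>
  define K where "K = r' * a * a + a' * r * a' + (r' * a' * r * a' + a' * a' + r' * a' * a')"
  obtain w :: "int \<Rightarrow> 'a" where w: "w 0 = a" "w 1 = a' * r + r' * a' * r"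
    and rec: "\<And>k. w (k + 1) = K * w k - C * w (k - 1)"
    using ex_two_sided_recurrence [OF inverse_C, of a "a' * r + r' * a' * r" K] by blast
  have "w (- 1) = C' * (K * w 0 - w 1)"
    using rec [of 0] by (simp add: mult.assoc [symmetric] inverse_C)
  then have m1: "w (- 1) = a * r' * a * a + a * r' * a' * r * a' + a * r' * a' * a'"
    unfolding w by (simp add: C'_def K_def unit_simps)
  have w2: "w 2 = K * (a' * r + r' * a' * r) - C * a"
    using rec [of 1] by (simp add: w)
  interpret conserved_recurrence C C' K w
    by unfold_locales (fact rec inverse_C | simp add: w w2 m1 C_def C'_def K_def unit_simps)+
  interpret positive_recurrence P C C' K w a a' "r' * a * a" "a' * r * a'"
    "r' * a' * r * a' + a' * a' + r' * a' * a'" 0 "a * r' * a' * a'"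
    by unfold_locales
      (auto simp: w m1 C_def C'_def K_def unit_simps intro!: zero_mem mem add_mem mult_mem)
  have "w 1 * C * w 0 - 1 = r"
    by (simp add: w C_def unit_simps)
  show ?thesis
  proof (intro exI conjI)
    show "solves 1 4 C (\<lambda>n. if even n then w (n div 2)
        else w (n div 2 + 1) * C * w (n div 2) - 1)"
      by (rule solves_even)
  qed (use \<open>w 1 * C * w 0 - 1 = r\<close> in \<open>simp_all add: w w_mem product_mem\<close>)
qed

lemma positive_solution_4_1: "\<exists>R. (\<forall>n. R n \<in> P) \<and> R 0 = a \<and> R 1 = r \<and> solves 4 1 C R"
proof -
  \<comment> \<open>Now \<open>w 0 = r\<close>, and \<open>a = w 0 * C * w (- 1) - 1\<close>
    determines \<open>w (- 1)\<close>. The exchange relation gives \<open>w 1\<close>, and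
    \<open>K\<close> is \<open>(w 1 + C * w (- 1)) * r'\<close> expanded.\<close>
  define K where "K = r' * a * r' + r * r * a' + (r' * a * r' * a' + r' * r' + r' * r' * a')"
  obtain w :: "int \<Rightarrow> 'a"
    where w: "w 0 = r" "w 1 = r * r * a' * r + r' * a * r' * a' * r + r' * r' * a' * r"
    and rec: "\<And>k. w (k + 1) = K * w k - C * w (k - 1)"
    using ex_two_sided_recurrence
      [OF inverse_C, of r "r * r * a' * r + r' * a * r' * a' * r + r' * r' * a' * r" K] by blast
  have "w (- 1) = C' * (K * w 0 - w 1)"
    using rec [of 0] by (simp add: mult.assoc [symmetric] inverse_C)
  then have m1: "w (- 1) = a * r' + a * r' * a'"
    unfolding w by (simp add: C'_def K_def unit_simps)
  have w2: "w 2 = K * (r * r * a' * r + r' * a * r' * a' * r + r' * r' * a' * r) - C * r"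
    using rec [of 1] by (simp add: w)
  interpret conserved_recurrence C C' K w
    by unfold_locales (fact rec inverse_C | simp add: w w2 m1 C_def C'_def K_def unit_simps)+
  interpret positive_recurrence P C C' K w r r' "r' * a * r'" "r * r * a'"
    "r' * a * r' * a' + r' * r' + r' * r' * a'" "r' * r' * a' * r" 0
    by unfold_locales
      (auto simp: w m1 C_def C'_def K_def unit_simps intro!: zero_mem mem add_mem mult_mem)
  have "w k * C * w (k - 1) - 1 \<in> P" for k
    using product_mem [of "k - 1"] by simp
  moreover have "w 0 * C * w (- 1) - 1 = a"
    by (simp add: w m1 C_def unit_simps)
  ultimately show ?thesis
  proof (intro exI conjI)
    show "solves 4 1 C (\<lambda>n. if odd n then w (n div 2)
        else w (n div 2) * C * w (n div 2 - 1) - 1)"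
      by (rule solves_odd)
  qed (simp_all add: w w_mem)
qed

end

subsection \<open>Laurent polynomials as a ring\<close>

text \<open>A local description of the fixed points of \<open>reduce\<close>, suited to list
  induction.\<close>

abbreviation reduced :: "letter list \<Rightarrow> bool" where
  "reduced \<equiv> successively (\<lambda>l m. \<not> cancels l m)"

lemma reduced_push: "reduced w \<Longrightarrow> reduced (push l w)"
  by (cases w) (auto simp: successively_Cons)

lemma reduced_reduce: "reduced (reduce w)"
  by (induction w) (auto simp: reduce_def reduced_push)

lemma reduce_reduced: "reduced w \<Longrightarrow> reduce w = w"
proof (induction w)
  case (Cons l w)
  then have "reduce (l # w) = push l w"
    by (simp add: reduce_def successively_Cons) auto
  with Cons.prems show ?case by (cases w) auto
qed (simp add: reduce_def)

lemma reduce_reduce [simp]: "reduce (reduce w) = reduce w"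
  by (simp add: reduce_reduced reduced_reduce)

lemma push_push_cancel: "cancels l m \<Longrightarrow> reduced w \<Longrightarrow> push l (push m w) = w"
  by (cases w; cases "tl w") (auto simp: cancels_def prod_eq_iff)

lemma reduced_foldr_push: "reduced w \<Longrightarrow> reduced (foldr push u w)"
  by (induction u) (auto intro: reduced_push)

text \<open>Letters act on reduced words through \<open>push\<close>, and inverse letters act
  inversely, so free reduction of \<open>u\<close> leaves its action unchanged. Associativity of the
  free group product rests on this.\<close>

lemma foldr_push_reduce: "reduced w \<Longrightarrow> foldr push (reduce u) w = foldr push u w"
proof (induction u)
  case (Cons l u)
  have "foldr push (push l v) w = push l (foldr push v w)" for v
    using Cons.prems
    by (cases v) (auto simp: push_push_cancel reduced_foldr_push)
  with Cons show ?case by (simp add: reduce_def)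
qed (simp add: reduce_def)

lemma reduce_append_left [simp]: "reduce (reduce u @ v) = reduce (u @ v)"
  using foldr_push_reduce [OF reduced_reduce] by (simp add: reduce_def)

lemma reduce_append_right [simp]: "reduce (u @ reduce v) = reduce (u @ v)"
  using reduce_reduce [of v] by (simp add: reduce_def)

typedef free_group = "{w. reduce w = w}"
  by (rule exI [of _ "[]"]) (simp add: reduce_def)

setup_lifting type_definition_free_group

lift_definition word :: "letter list \<Rightarrow> free_group" is reduce by simp

text \<open>Multiplication in \<open>Poly_Mapping\<close> is convolution over added keys, hence the
  additive notation for a non-commutative group law.\<close>

instantiation free_group :: monoid_add
begin

lift_definition zero_free_group :: free_group is "[]" by (simp add: reduce_def)

lift_definition plus_free_group :: "free_group \<Rightarrow> free_group \<Rightarrow> free_group"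
  is "\<lambda>u v. reduce (u @ v)" by simp

instance
proof
  fix a b c :: free_group
  show "a + b + c = a + (b + c)" by transfer simp
  show "0 + a = a" "a + 0 = a" by (transfer, simp)+
qed

end

lemma word_add: "word u + word v = word (u @ v)"
  by transfer simp

lemma word_Nil: "word [] = 0"
  by transfer (simp add: reduce_def)

lemma word_eq_iff: "word u = word v \<longleftrightarrow> reduce u = reduce v"
  by transfer (rule refl)

lemma word_Rep [simp]: "word (Rep_free_group g) = g"
  using Rep_free_group [of g] by (simp add: Rep_free_group_inject [symmetric] word.rep_eq)

text \<open>The value 0 off reduced words matters: \<open>word\<close> also accepts unreduced lists
  and would repeat coefficients there.\<close>

definition lp :: "(free_group \<Rightarrow>\<^sub>0 int) \<Rightarrow> lpoly" where
  "lp p = (\<lambda>w. if reduce w = w then Poly_Mapping.lookup p (word w) else 0)"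

lemma lp_Rep [simp]: "lp p (Rep_free_group g) = Poly_Mapping.lookup p g"
  using Rep_free_group [of g] by (simp add: lp_def)

lemma word_support: "lp p w \<noteq> 0 \<Longrightarrow> \<exists>g. w = Rep_free_group g \<and> Poly_Mapping.lookup p g \<noteq> 0"
  by (auto simp: lp_def word.rep_eq split: if_splits intro!: exI [of _ "word w"])

lemma is_lpoly_lp: "is_lpoly (lp p)"
proof -
  have "{w. lp p w \<noteq> 0} \<subseteq> Rep_free_group ` Poly_Mapping.keys p"
    by (auto dest!: word_support simp: in_keys_iff)
  then have "finite {w. lp p w \<noteq> 0}" by (rule finite_subset) simp
  then show ?thesis by (auto simp: is_lpoly_def lp_def)
qed

lemma lp_single: "lp (Poly_Mapping.single (word u) 1) = lp_mono u"
  by (auto simp: lp_def lp_mono_def fun_eq_iff lookup_single when_def word_eq_iff)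

lemma lp_1: "lp 1 = lp_one"
  using lp_single [of "[]"] by (simp add: word_Nil lp_one_def lp_mono_def reduce_def)

lemma lp_plus: "lp (p + q) = lp_add (lp p) (lp q)"
  by (auto simp: lp_def lp_add_def lookup_add)

text \<open>Both sides are convolutions: \<open>Rep_free_group\<close> matches the factorisations of
  \<open>word w\<close> in the supports with the pairs of words summed by \<open>lp_mult\<close>. At
  unreduced \<open>w\<close> both sides vanish.\<close>

lemma lp_times: "lp (p * q) = lp_mult (lp p) (lp q)"
proof
  fix w
  let ?T = "{(u, v). lp p u \<noteq> 0 \<and> lp q v \<noteq> 0 \<and> reduce (u @ v) = w}"
  show "lp (p * q) w = lp_mult (lp p) (lp q) w"
  proof (cases "reduce w = w")
    case False
    then have "?T = {}" by auto
    then have "lp_mult (lp p) (lp q) w = 0"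
      unfolding lp_mult_def by (simp only: sum.empty)
    with False show ?thesis by (simp add: lp_def)
  next
    case True
    let ?p = "Poly_Mapping.lookup p" and ?q = "Poly_Mapping.lookup q"
    let ?S = "{(g, h). ?p g \<noteq> 0 \<and> ?q h \<noteq> 0 \<and> word w = g + h}"
    have fin: "finite ?S"
      by (rule finite_subset [of _ "Poly_Mapping.keys p \<times> Poly_Mapping.keys q"])
        (auto simp: in_keys_iff)
    have sum_eq: "word w = g + h \<longleftrightarrow> reduce (Rep_free_group g @ Rep_free_group h) = w" for g h
      using True by (auto simp: Rep_free_group_inject [symmetric] plus_free_group.rep_eq word.rep_eq)
    have "lp (p * q) w = prod_fun ?p ?q (word w)"
      using True by (simp add: lp_def times_poly_mapping.rep_eq)
    also have "\<dots> = (\<Sum>(g, h). ?p g * ?q h when word w = g + h)"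
      by (rule prod_fun_unfold_prod) simp_all
    also have "\<dots> = (\<Sum>(g, h) \<in> ?S. ?p g * ?q h when word w = g + h)"
      by (rule Sum_any.expand_superset [OF fin]) (auto simp: when_def split: if_splits)
    also have "\<dots> = (\<Sum>(g, h) \<in> ?S. ?p g * ?q h)"
      by (rule sum.cong) (auto simp: when_def)
    also have "\<dots> = (\<Sum>(u, v) \<in> map_prod Rep_free_group Rep_free_group ` ?S. lp p u * lp q v)"
      by (subst sum.reindex) (auto simp: inj_on_def Rep_free_group_inject intro!: sum.cong)
    also have "map_prod Rep_free_group Rep_free_group ` ?S = ?T"
    proof (intro equalityI subsetI)
      fix x assume "x \<in> ?T"
      then obtain u v where x: "x = (u, v)" "lp p u \<noteq> 0" "lp q v \<noteq> 0" "reduce (u @ v) = w"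
        by auto
      then obtain g h where "u = Rep_free_group g" "v = Rep_free_group h"
        using word_support by metis
      with x have "(g, h) \<in> ?S" "x = map_prod Rep_free_group Rep_free_group (g, h)"
        by (simp_all add: sum_eq)
      then show "x \<in> map_prod Rep_free_group Rep_free_group ` ?S" by blast
    qed (auto simp: sum_eq)
    finally show ?thesis by (simp add: lp_mult_def)
  qed
qed

lemma lp_power: "lp (p ^ k) = lp_pow (lp p) k"
  by (induction k) (simp_all add: lp_1 lp_times)

section \<open>The two systems for Laurent polynomials\<close>

lemma bc_system_lp:
  assumes "solves b c C R"
  shows "bc_system b c (lp C) (\<lambda>n. lp (R n))"
  unfolding bc_system_def
proof
  fix n :: int
  have "lp (R (n + 1) * C * R (n - 1)) = lp (1 + R n ^ (if odd n then b else c))"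
    using assms by (simp add: solves_def)
  then show "lp_mult (lp_mult (lp (R (n + 1))) (lp C)) (lp (R (n - 1)))
      = lp_add lp_one (lp_pow (lp (R n)) (if odd n then b else c))"
    by (simp only: lp_times lp_plus lp_1 lp_power)
qed

definition nonneg_cone :: "(free_group \<Rightarrow>\<^sub>0 int) set" where
  "nonneg_cone = {p. lp_nonneg (lp p)}"

lemma single_mem: "Poly_Mapping.single g 1 \<in> nonneg_cone"
  by (simp add: nonneg_cone_def lp_nonneg_def lp_def lookup_single when_def)

interpretation nonneg: positive_cone nonneg_cone
proof
  show "0 \<in> nonneg_cone"
    by (simp add: nonneg_cone_def lp_nonneg_def lp_def)
  show "1 \<in> nonneg_cone"
    using single_mem [of 0] by simp
  fix p q assume "p \<in> nonneg_cone" "q \<in> nonneg_cone"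
  then show "p + q \<in> nonneg_cone" "p * q \<in> nonneg_cone"
    by (auto simp: nonneg_cone_def lp_nonneg_def lp_plus lp_add_def lp_times lp_mult_def
        intro!: sum_nonneg)
qed

abbreviation monomial :: "letter list \<Rightarrow> free_group \<Rightarrow>\<^sub>0 int" where
  "monomial u \<equiv> Poly_Mapping.single (word u) 1"

lemma monomial_mult: "monomial u * monomial v = monomial (u @ v)"
  by (simp add: mult_single word_add)

lemma monomial_inverse: "reduce (u @ v) = [] \<Longrightarrow> monomial u * monomial v = 1"
  by (metis monomial_mult single_one word_Nil word_eq_iff reduce_reduce)

interpretation nonneg: positive_pair nonneg_cone
  "monomial [gy, gx, gy']" "monomial [gy, gx', gy']" "monomial [gy]" "monomial [gy']"
  by unfold_locales
    (rule single_mem | rule monomial_inverse, simp add: reduce_def cancels_def)+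

text \<open>Substituting \<open>a = y x y'\<close> and \<open>r = y\<close> in
  \<open>r' * a * r * a'\<close> and reducing freely leaves \<open>x y x' y'\<close>.\<close>

lemma lp_coefficient: "lp nonneg.C = lp_C"
  unfolding nonneg.C_def monomial_mult lp_single lp_C_def lp_mono_def
  by (simp add: reduce_def cancels_def)

lemma positive_bc_system:
  assumes "(b, c) \<in> {(1, 4), (4, 1 :: nat)}"
  shows "\<exists>R. (\<forall>n. is_lpoly (R n) \<and> lp_nonneg (R n))
    \<and> R 0 = lp_mono [gy, gx, gy'] \<and> R 1 = lp_mono [gy] \<and> bc_system b c lp_C R"
proof -
  obtain R where R: "\<And>n. R n \<in> nonneg_cone" "R 0 = monomial [gy, gx, gy']" "R 1 = monomial [gy]"
    "solves b c nonneg.C R"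
    using assms nonneg.positive_solution_1_4 nonneg.positive_solution_4_1 by auto
  show ?thesis
  proof (intro exI conjI allI)
    show "is_lpoly (lp (R n))" "lp_nonneg (lp (R n))" for n
      using R(1) [of n] by (simp_all add: nonneg_cone_def is_lpoly_lp)
    show "bc_system b c lp_C (\<lambda>n. lp (R n))"
      using bc_system_lp [OF R(4)] by (simp only: lp_coefficient)
  qed (simp_all only: R(2,3) lp_single)
qed

text \<open>A shift by one flips parity and so swaps the exponents. It turns the first claim for
  \<open>(c, b)\<close> into the second claim for \<open>(b, c)\<close>.\<close>

lemma bc_system_shift:
  assumes "bc_system b c C R"
  shows "bc_system c b C (\<lambda>n. R (n - 1))"
  unfolding bc_system_def
proof
  fix n :: int
  show "lp_mult (lp_mult (R (n + 1 - 1)) C) (R (n - 1 - 1))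
      = lp_add lp_one (lp_pow (R (n - 1)) (if odd n then c else b))"
    using assms [unfolded bc_system_def, rule_format, of "n - 1"] by simp
qed

theorem theorem4p13:
  fixes b c :: nat
  assumes "(b, c) \<in> {(1, 4), (4, 1)}"
  shows "(\<exists>R :: int \<Rightarrow> lpoly.
            (\<forall>n. is_lpoly (R n) \<and> lp_nonneg (R n))
          \<and> R 0 = lp_mono [gy, gx, gy'] \<and> R 1 = lp_mono [gy]
          \<and> bc_system b c lp_C R)
       \<and> (\<exists>R :: int \<Rightarrow> lpoly.
            (\<forall>n. is_lpoly (R n) \<and> lp_nonneg (R n))
          \<and> R 1 = lp_mono [gy, gx, gy'] \<and> R 2 = lp_mono [gy]
          \<and> bc_system b c lp_C R)"
proof
  show "\<exists>R :: int \<Rightarrow> lpoly. (\<forall>n. is_lpoly (R n) \<and> lp_nonneg (R n))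
      \<and> R 0 = lp_mono [gy, gx, gy'] \<and> R 1 = lp_mono [gy] \<and> bc_system b c lp_C R"
    using assms by (rule positive_bc_system)
next
  have "(c, b) \<in> {(1, 4), (4, 1)}"
    using assms by auto
  then obtain R where "\<forall>n. is_lpoly (R n) \<and> lp_nonneg (R n)"
    "R 0 = lp_mono [gy, gx, gy']" "R 1 = lp_mono [gy]" "bc_system c b lp_C R"
    using positive_bc_system by blast
  then show "\<exists>R :: int \<Rightarrow> lpoly. (\<forall>n. is_lpoly (R n) \<and> lp_nonneg (R n))
      \<and> R 1 = lp_mono [gy, gx, gy'] \<and> R 2 = lp_mono [gy] \<and> bc_system b c lp_C R"
    by (intro exI [of _ "\<lambda>n. R (n - 1)"]) (simp add: bc_system_shift)
qed

end
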